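(* Let $h>0$, let $\varphi:\mathbb{R}\to\mathbb{R}$ be a limiter satisfying $$\max(0,r)\le\varphi(r)\le1\ (r\le1),\qquad 1\le\varphi(r)\le\min(r,2)\ (r\ge1),\qquad \varphi(r)\le r\,\varphi(1/r)\ (r\ge1),$$ such that $L_\varphi$ is Lipschitz continuous on $\mathbb{R}^3$, and suppose that for some real $\alpha$ with $1\le\alpha\le2$ $$\varphi(r)\le(\alpha-2)\,r\ (r\le0),\qquad \varphi(r)\le\alpha\ (r>0).$$ Let $\Phi:\mathbb{R}^2\to\mathbb{R}$ be a consistent numerical flux, Lipschitz continuous on the compact sets of $\mathbb{R}^2$, absolutely continuous with respect to each variable, $$\Phi(u,v)=\Phi(u_0,v)+\int_{u_0}^u\Phi_u(\xi,v)\,d\xi,\qquad \Phi(u,v)=\Phi(u,v_0)+\int_{v_0}^v\Phi_v(u,\xi)\,d\xi,$$ and monotone: $\Phi_u\ge0$, $\Phi_v\le0$. Let $(u_j^0)_{j\in\mathbb{Z}}$ satisfy $\sup_j|u_j^0|<\infty$ and $\sum_{j}|u_{j+1}^0-u_j^0|<\infty$, let $T>0$, and let $(u_j(t))_{j\in\mathbb{Z}}$, $t\in[0,T]$, in $C^1([0,T];\ell^\infty(\mathbb{Z}))$, be the solution of $$\frac{du_j}{dt}+\frac1h\Big(\Phi(u_{j+1/2}^-,u_{j+1/2}^+)-\Phi(u_{j-1/2}^-,u_{j-1/2}^+)\Big)=0,\qquad u_j(0)=u_j^0\qquad(j\in\mathbb{Z}).$$ Then $$\inf_{\ell\in\mathbb{Z}}u_\ell^0\le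 u_j(t)\le\sup_{\ell\in\mathbb{Z}}u_\ell^0\qquad\text{for all }j\in\mathbb{Z},\ 0\le t\le T.$$
   Context: Interpolation: for $\varphi:\mathbb{R}\to\mathbb{R}$, put $L_\varphi(u,v,w)=v+\frac12\varphi\big(\frac{v-u}{w-v}\big)(w-v)$ if $w\neq v$, $L_\varphi(u,v,v)=v$, and $R_\varphi(u,v,w)=L_\varphi(w,v,u)$. For a real sequence $(u_j)_{j\in\mathbb{Z}}$ the interpolated values are $u_{j+1/2}^-=L_\varphi(u_{j-1},u_j,u_{j+1})$ and $u_{j+1/2}^+=R_\varphi(u_j,u_{j+1},u_{j+2})$. Flux: $f:\mathbb{R}\to\mathbb{R}$ is a convex $C^2$ function; $\Phi$ is consistent if $\Phi(u,u)=f(u)$ for all $u$. *)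

theory Defs
  imports "HOL-Analysis.Analysis"
begin

definition L_interp :: "(real \<Rightarrow> real) \<Rightarrow> real \<Rightarrow> real \<Rightarrow> real \<Rightarrow> real" where
  "L_interp \<phi> u v w = (if w \<noteq> v then v + 1/2 * \<phi> ((v - u) / (w - v)) * (w - v) else v)"

definition R_interp :: "(real \<Rightarrow> real) \<Rightarrow> real \<Rightarrow> real \<Rightarrow> real \<Rightarrow> real" where
  "R_interp \<phi> u v w = L_interp \<phi> w v u"

text \<open>Half-integer positions are encoded by their left neighbour: index \<open>j\<close> stands for the
  interface \<open>j + 1/2\<close>, so the values at \<open>j - 1/2\<close> are obtained at index \<open>j - 1\<close>.\<close>

definition interface_minus :: "(real \<Rightarrow> real) \<Rightarrow> (int \<Rightarrow> real) \<Rightarrow> int \<Rightarrow> real" where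
  "interface_minus \<phi> u j = L_interp \<phi> (u (j - 1)) (u j) (u (j + 1))"

definition interface_plus :: "(real \<Rightarrow> real) \<Rightarrow> (int \<Rightarrow> real) \<Rightarrow> int \<Rightarrow> real" where
  "interface_plus \<phi> u j = R_interp \<phi> (u j) (u (j + 1)) (u (j + 2))"

definition interface_flux ::
    "(real \<Rightarrow> real \<Rightarrow> real) \<Rightarrow> (real \<Rightarrow> real) \<Rightarrow> (int \<Rightarrow> real) \<Rightarrow> int \<Rightarrow> real" where
  "interface_flux \<Phi> \<phi> u j = \<Phi> (interface_minus \<phi> u j) (interface_plus \<phi> u j)"

text \<open>\<open>g\<close> is the oriented Lebesgue integral of the locally integrable function \<open>g'\<close>, which is
  then the almost everywhere derivative of \<open>g\<close>.\<close>

definition abs_cont_with_derivative :: "(real \<Rightarrow> real) \<Rightarrow> (real \<Rightarrow> real) \<Rightarrow> bool" where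
  "abs_cont_with_derivative g g' \<longleftrightarrow>
     (\<forall>a b. interval_lebesgue_integrable lebesgue (ereal a) (ereal b) g' \<and>
            g b = g a + (LINT \<xi>=ereal a..ereal b|lebesgue. g' \<xi>))"

end

theory Submission
  imports Defs
begin

text \<open>
  The upper bound is a maximum principle.  Suppose first that a sequence attains its supremum at
  \<open>j\<close>.  Then \<open>u (j + 1) - u j \<le> 0\<close>, so the slope ratio at \<open>j\<close> is nonpositive and the hypothesis
  \<open>\<phi> r \<le> (\<alpha> - 2) r\<close> keeps the left value at \<open>j + 1/2\<close> above
  \<open>u j - (1 - \<alpha>/2) (u j - u (j - 1))\<close>; the hypothesis \<open>\<phi> \<le> \<alpha>\<close> keeps the left value at \<open>j - 1/2\<close>
  below the very same number.  The right values are ordered in the opposite way by reflection, and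
  monotonicity of \<open>\<Phi>\<close> makes the flux difference at \<open>j\<close> nonnegative
  (\<open>interface_flux_mono_at_max\<close>).

  On an infinite grid the supremum need not be attained, so this is made quantitative.  Let \<open>K\<close> be
  the supremum of \<open>u\<close> over \<open>[0,T]\<close> and all indices.  Raising the single entry \<open>u j\<close> to \<open>K\<close> produces
  a maximum at \<open>j\<close> and changes the two fluxes by at most a constant times \<open>K - u j\<close>, because
  interpolation and flux are Lipschitz on bounded sets.  Hence \<open>u j' \<le> C (K - u j)\<close> with \<open>C\<close>
  independent of \<open>j\<close> and \<open>t\<close>, and integrating,
  \<open>K - u j \<ge> exp (- C T) (K - M)\<close> for any upper bound \<open>M\<close> of the initial data.  The infimum
  of the left-hand side over \<open>t\<close> and \<open>j\<close> is \<open>0\<close>, so \<open>K \<le> M\<close> (\<open>maximum_principle\<close>).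

  The lower bound is the upper bound for \<open>- u\<close>, which solves the scheme with the flux
  \<open>- \<Phi> (- a) (- b)\<close>, again monotone and locally Lipschitz, since the interpolation is odd.
\<close>

section \<open>Interpolation near a maximum\<close>

text \<open>The properties of a limiter on which the maximum principle rests.\<close>

locale alpha_limiter =
  fixes \<phi> :: "real \<Rightarrow> real" and \<alpha> :: real
  assumes nonneg: "0 \<le> \<phi> r"
    and le_alpha: "\<phi> r \<le> \<alpha>"
    and alpha_le_2: "\<alpha> \<le> 2"
    and le_at_nonpos: "r \<le> 0 \<Longrightarrow> \<phi> r \<le> (\<alpha> - 2) * r"
begin

lemma L_interp_le:
  assumes "v \<le> w"
  shows "L_interp \<phi> a v w \<le> v + \<alpha> / 2 * (w - v)"
proof (cases "w = v")
  case False
  have "\<phi> ((v - a) / (w - v)) * (w - v) \<le> \<alpha> * (w - v)"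
    using assms le_alpha by (intro mult_right_mono) auto
  with False show ?thesis
    unfolding L_interp_def by simp
qed (simp add: L_interp_def)

lemma L_interp_ge_at_max:
  assumes "a \<le> v" "w \<le> v"
  shows "v - (1 - \<alpha> / 2) * (v - a) \<le> L_interp \<phi> a v w"
proof (cases "w = v")
  case True
  have "0 \<le> (1 - \<alpha> / 2) * (v - a)"
    using assms alpha_le_2 by simp
  with True show ?thesis
    by (simp add: L_interp_def)
next
  case False
  then have neg: "w - v < 0"
    using assms by simp
  have "\<phi> ((v - a) / (w - v)) \<le> (\<alpha> - 2) * ((v - a) / (w - v))"
    using assms neg by (intro le_at_nonpos divide_nonneg_neg) auto
  then have "(\<alpha> - 2) * ((v - a) / (w - v)) * (w - v) \<le> \<phi> ((v - a) / (w - v)) * (w - v)"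
    using neg by (intro mult_right_mono_neg) auto
  then have "(\<alpha> - 2) * (v - a) \<le> \<phi> ((v - a) / (w - v)) * (w - v)"
    using neg by simp
  with False show ?thesis
    unfolding L_interp_def by argo
qed

lemma abs_L_interp_le:
  assumes "\<bar>v\<bar> \<le> B" "\<bar>w\<bar> \<le> B"
  shows "\<bar>L_interp \<phi> a v w\<bar> \<le> 3 * B"
proof -
  define p where "p = \<phi> ((v - a) / (w - v))"
  have p: "\<bar>p\<bar> \<le> 2"
    unfolding p_def using nonneg le_alpha alpha_le_2 by (smt (verit))
  have "\<bar>p * (w - v)\<bar> \<le> 2 * (2 * B)"
    unfolding abs_mult using p assms by (intro mult_mono) auto
  then show ?thesis
    using assms unfolding L_interp_def p_def[symmetric] by auto
qed

text \<open>For a maximum at \<open>j\<close>, both \<open>u\<^sub>j\<^sub>+\<^sub>1\<^sub>/\<^sub>2\<^sup>-\<close> and \<open>u\<^sub>j\<^sub>-\<^sub>1\<^sub>/\<^sub>2\<^sup>-\<close> are compared with \<open>u j - (1 - \<alpha>/2) (u j - u (j - 1))\<close>, and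
  both plus values with \<open>u j - (1 - \<alpha>/2) (u j - u (j + 1))\<close>.\<close>

lemma interface_flux_mono_at_max:
  assumes mono: "\<And>a a' b. a \<le> a' \<Longrightarrow> \<Phi> a b \<le> \<Phi> a' b"
    and anti: "\<And>a b b'. b \<le> b' \<Longrightarrow> \<Phi> a b' \<le> \<Phi> a b"
    and max: "\<And>l. x l \<le> x j"
  shows "interface_flux \<Phi> \<phi> x (j - 1) \<le> interface_flux \<Phi> \<phi> x j"
proof -
  have "interface_minus \<phi> x (j - 1) \<le> x (j - 1) + \<alpha> / 2 * (x j - x (j - 1))"
    using L_interp_le[OF max] by (simp add: interface_minus_def)
  also have "\<dots> = x j - (1 - \<alpha> / 2) * (x j - x (j - 1))"
    by (simp add: field_simps)
  also have "\<dots> \<le> interface_minus \<phi> x j"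
    using L_interp_ge_at_max[OF max max] by (simp add: interface_minus_def)
  finally have minus: "interface_minus \<phi> x (j - 1) \<le> interface_minus \<phi> x j" .
  have "interface_plus \<phi> x j \<le> x (j + 1) + \<alpha> / 2 * (x j - x (j + 1))"
    using L_interp_le[OF max] by (simp add: interface_plus_def R_interp_def)
  also have "\<dots> = x j - (1 - \<alpha> / 2) * (x j - x (j + 1))"
    by (simp add: field_simps)
  also have "\<dots> \<le> interface_plus \<phi> x (j - 1)"
    using L_interp_ge_at_max[OF max max, of "j + 1" "j - 1"]
    by (simp add: interface_plus_def R_interp_def add.commute)
  finally have plus: "interface_plus \<phi> x j \<le> interface_plus \<phi> x (j - 1)" .
  show ?thesis
    unfolding interface_flux_def using mono[OF minus] anti[OF plus] order_trans by blast
qed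

text \<open>On sequences bounded by \<open>B\<close> the interface values stay in \<open>[- 3 B, 3 B]\<close>, so the flux is only
  needed on a fixed compact square.\<close>

lemma interface_flux_lipschitz:
  assumes L: "C-lipschitz_on UNIV (\<lambda>(a, b, c). L_interp \<phi> a b c)"
    and Phi: "D-lipschitz_on (cbox (- 3 * B, - 3 * B) (3 * B, 3 * B)) (\<lambda>(a, b). \<Phi> a b)"
    and bound: "\<And>l. \<bar>x l\<bar> \<le> B" "\<And>l. \<bar>y l\<bar> \<le> B"
    and close: "\<And>l. \<bar>x l - y l\<bar> \<le> d"
  shows "\<bar>interface_flux \<Phi> \<phi> x j - interface_flux \<Phi> \<phi> y j\<bar> \<le> 6 * C * D * d"
proof -
  have C: "0 \<le> C" and D: "0 \<le> D"
    using L Phi lipschitz_on_nonneg by auto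
  have L_close: "\<bar>L_interp \<phi> (x k) (x l) (x m) - L_interp \<phi> (y k) (y l) (y m)\<bar> \<le> 3 * C * d"
    for k l m
  proof -
    have "\<bar>L_interp \<phi> (x k) (x l) (x m) - L_interp \<phi> (y k) (y l) (y m)\<bar>
        \<le> C * dist (x k, x l, x m) (y k, y l, y m)"
      using lipschitz_onD[OF L, of "(x k, x l, x m)" "(y k, y l, y m)"] by (simp add: dist_real_def)
    moreover have "dist (x k, x l, x m) (y k, y l, y m)
        \<le> \<bar>x k - y k\<bar> + (\<bar>x l - y l\<bar> + \<bar>x m - y m\<bar>)"
      unfolding dist_norm minus_prod_def fst_conv snd_conv
      by (smt (verit) norm_Pair_le real_norm_def)
    then have "dist (x k, x l, x m) (y k, y l, y m) \<le> 3 * d"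
      using close[of k] close[of l] close[of m] by simp
    then have "C * dist (x k, x l, x m) (y k, y l, y m) \<le> C * (3 * d)"
      using C by (rule mult_left_mono)
    ultimately show ?thesis
      by (simp add: mult_ac)
  qed
  let ?p = "(interface_minus \<phi> x j, interface_plus \<phi> x j)"
  let ?q = "(interface_minus \<phi> y j, interface_plus \<phi> y j)"
  have box: "(interface_minus \<phi> z j, interface_plus \<phi> z j)
      \<in> cbox (- 3 * B, - 3 * B) (3 * B, 3 * B)" if "\<And>l. \<bar>z l\<bar> \<le> B" for z
  proof -
    have "\<bar>interface_minus \<phi> z j\<bar> \<le> 3 * B" "\<bar>interface_plus \<phi> z j\<bar> \<le> 3 * B"
      unfolding interface_minus_def interface_plus_def R_interp_def
      by (rule abs_L_interp_le[OF that that])+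
    then show ?thesis
      by (auto simp: cbox_Pair_eq abs_le_iff)
  qed
  have flux: "\<bar>interface_flux \<Phi> \<phi> x j - interface_flux \<Phi> \<phi> y j\<bar> \<le> D * dist ?p ?q"
    using lipschitz_onD[OF Phi, of ?p ?q] box bound by (simp add: dist_real_def interface_flux_def)
  have "dist ?p ?q \<le> \<bar>interface_minus \<phi> x j - interface_minus \<phi> y j\<bar>
      + \<bar>interface_plus \<phi> x j - interface_plus \<phi> y j\<bar>"
    unfolding dist_norm minus_prod_def fst_conv snd_conv by (metis norm_Pair_le real_norm_def)
  moreover have "\<dots> \<le> 3 * C * d + 3 * C * d"
    unfolding interface_minus_def interface_plus_def R_interp_def by (intro add_mono L_close)
  ultimately have "dist ?p ?q \<le> 6 * C * d"
    by linarith
  then have "D * dist ?p ?q \<le> D * (6 * C * d)"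
    using D by (rule mult_left_mono)
  with flux show ?thesis
    by (simp add: mult_ac)
qed

section \<open>The maximum principle\<close>

lemma maximum_principle:
  fixes u u' :: "real \<Rightarrow> int \<Rightarrow> real"
  assumes h: "0 < h" and T: "0 < T"
    and L: "\<exists>C. C-lipschitz_on UNIV (\<lambda>(a, b, c). L_interp \<phi> a b c)"
    and Phi: "\<And>K. compact K \<Longrightarrow> \<exists>C. C-lipschitz_on K (\<lambda>(a, b). \<Phi> a b)"
    and mono: "\<And>a a' b. a \<le> a' \<Longrightarrow> \<Phi> a b \<le> \<Phi> a' b"
    and anti: "\<And>a b b'. b \<le> b' \<Longrightarrow> \<Phi> a b' \<le> \<Phi> a b"
    and bound: "\<And>t j. t \<in> {0..T} \<Longrightarrow> \<bar>u t j\<bar> \<le> B"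
    and deriv: "\<And>t j. t \<in> {0..T} \<Longrightarrow>
      ((\<lambda>s. u s j) has_real_derivative u' t j) (at t within {0..T})"
    and scheme: "\<And>t j. t \<in> {0..T} \<Longrightarrow>
      u' t j + 1 / h * (interface_flux \<Phi> \<phi> (u t) j - interface_flux \<Phi> \<phi> (u t) (j - 1)) = 0"
    and initial: "\<And>j. u 0 j \<le> M"
    and t: "t \<in> {0..T}"
  shows "u t j \<le> M"
proof -
  define S where "S = (\<lambda>(t, j). u t j) ` ({0..T} \<times> UNIV)"
  define K where "K = Sup S"
  have S: "S \<noteq> {}" "bdd_above S"
    using T bound unfolding S_def by (auto intro!: bdd_aboveI[of _ B] simp: abs_le_iff)
  \<comment> \<open>\<open>K\<close> is a supremum over space and time, so that it does not move with \<open>t\<close> below.\<close>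
  have le_K: "u t j \<le> K" if "t \<in> {0..T}" for t j
    unfolding K_def using S that by (intro cSup_upper) (auto simp: S_def)
  have abs_K: "\<bar>K\<bar> \<le> B"
  proof -
    have "K \<le> B"
      unfolding K_def using S bound by (intro cSup_least) (auto simp: S_def abs_le_iff)
    moreover have "- B \<le> K"
      using le_K[OF t, of 0] bound[OF t, of 0] by simp
    ultimately show ?thesis
      by simp
  qed
  obtain C D where C: "C-lipschitz_on UNIV (\<lambda>(a, b, c). L_interp \<phi> a b c)"
    and D: "D-lipschitz_on (cbox (- 3 * B, - 3 * B) (3 * B, 3 * B)) (\<lambda>(a, b). \<Phi> a b)"
    using L Phi[OF compact_cbox] by blast
  define c where "c = 12 * C * D / h"
  have c: "0 \<le> c"
    unfolding c_def using h C D lipschitz_on_nonneg by (metis divide_nonneg_pos mult_nonneg_nonneg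
        zero_le_numeral)
  have growth: "u' t j \<le> c * (K - u t j)" if t: "t \<in> {0..T}" for t j
  proof -
    let ?x = "u t" and ?y = "(u t)(j := K)"
    have y: "\<bar>?y l\<bar> \<le> B" "\<bar>?x l - ?y l\<bar> \<le> K - u t j" for l
      using bound[OF t] abs_K le_K[OF t] by auto
    \<comment> \<open>The sequence \<open>?y\<close> attains its maximum \<open>K\<close> at \<open>j\<close> and differs from \<open>u t\<close> only there.\<close>
    have "interface_flux \<Phi> \<phi> ?y (j - 1) \<le> interface_flux \<Phi> \<phi> ?y j"
      by (rule interface_flux_mono_at_max) (use mono anti le_K[OF t] in auto)
    moreover have "\<bar>interface_flux \<Phi> \<phi> ?x i - interface_flux \<Phi> \<phi> ?y i\<bar>
        \<le> 6 * C * D * (K - u t j)" for i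
      by (rule interface_flux_lipschitz[OF C D bound[OF t] y])
    from this[of j] this[of "j - 1"]
    have "\<bar>interface_flux \<Phi> \<phi> ?x j - interface_flux \<Phi> \<phi> ?y j\<bar> \<le> 6 * C * D * (K - u t j)"
      "\<bar>interface_flux \<Phi> \<phi> ?x (j - 1) - interface_flux \<Phi> \<phi> ?y (j - 1)\<bar>
        \<le> 6 * C * D * (K - u t j)" .
    ultimately have "- (interface_flux \<Phi> \<phi> ?x j - interface_flux \<Phi> \<phi> ?x (j - 1))
        \<le> 12 * C * D * (K - u t j)"
      by linarith
    then have "- (interface_flux \<Phi> \<phi> ?x j - interface_flux \<Phi> \<phi> ?x (j - 1)) / h
        \<le> 12 * C * D * (K - u t j) / h"
      using h by (intro divide_right_mono) auto
    moreover have "u' t j = - (interface_flux \<Phi> \<phi> ?x j - interface_flux \<Phi> \<phi> ?x (j - 1)) / h"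
      using scheme[OF t, of j] by (simp add: diff_divide_distrib)
    ultimately show ?thesis
      by (simp add: c_def)
  qed
  have decay: "exp (- c * T) * (K - M) \<le> K - u t j" if M: "M \<le> K" and t: "t \<in> {0..T}" for t j
  proof -
    define g where "g = (\<lambda>s. exp (c * s) * (K - u s j))"
    have g': "(g has_real_derivative exp (c * s) * (c * (K - u s j) - u' s j)) (at s within {0..T})"
      if "s \<in> {0..T}" for s
      unfolding g_def
      by (rule derivative_eq_intros deriv that refl | simp add: algebra_simps)+
    have "g 0 \<le> g t"
    proof (rule DERIV_nonneg_imp_increasing_open[of 0 t])
      show "\<exists>y. DERIV g s :> y \<and> 0 \<le> y" if "0 < s" "s < t" for s
      proof -
        have s: "s \<in> {0..T}"
          using that t by simp
        have "at s within {0..T} = at s"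
          using that t by (intro at_within_Icc_at) auto
        with g'[OF s] growth[OF s, of j] show ?thesis
          by (metis diff_ge_0_iff_ge exp_ge_zero mult_nonneg_nonneg)
      qed
      have "continuous_on {0..T} g"
        using g' by (rule DERIV_continuous_on)
      then show "continuous_on {0..t} g"
        using t by (auto intro: continuous_on_subset)
    qed (use t in auto)
    then have "K - M \<le> exp (c * t) * (K - u t j)"
      unfolding g_def using initial[of j] by simp
    then have "exp (- c * t) * (K - M) \<le> exp (- c * t) * (exp (c * t) * (K - u t j))"
      by (intro mult_left_mono) auto
    also have "\<dots> = K - u t j"
      by (simp add: mult.assoc[symmetric] exp_add[symmetric])
    finally have "exp (- c * t) * (K - M) \<le> K - u t j" .
    moreover have "exp (- c * T) * (K - M) \<le> exp (- c * t) * (K - M)"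
      using M t c by (intro mult_right_mono) (auto intro: mult_left_mono)
    ultimately show ?thesis
      by simp
  qed
  have "K \<le> M"
  proof (rule ccontr)
    assume "\<not> K \<le> M"
    then have MK: "M < K"
      by simp
    have "u t j \<le> K - exp (- c * T) * (K - M)" if "t \<in> {0..T}" for t j
      using decay[OF less_imp_le[OF MK] that, of j] by simp
    then have "K \<le> K - exp (- c * T) * (K - M)"
      using S by (subst (1) K_def, intro cSup_least) (auto simp: S_def)
    then have "exp (- c * T) * (K - M) \<le> 0"
      by simp
    then show False
      using MK by (simp add: mult_le_0_iff not_less[symmetric])
  qed
  with le_K[OF t, of j] show ?thesis
    by simp
qed

end

section \<open>Monotone fluxes and reflection\<close>

lemma abs_cont_with_nonneg_derivative_mono:
  assumes g: "abs_cont_with_derivative g g'" and pos: "AE x in lebesgue. 0 \<le> g' x"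
    and le: "a \<le> b"
  shows "g a \<le> g b"
proof -
  have "AE x in lebesgue. 0 \<le> indicator (einterval (ereal a) (ereal b)) x *\<^sub>R g' x"
    using pos by eventually_elim simp
  then have "0 \<le> (LINT x=ereal a..ereal b|lebesgue. g' x)"
    using le unfolding interval_lebesgue_integral_def set_lebesgue_integral_def
    by (simp add: integral_nonneg_AE)
  moreover have "g b = g a + (LINT x=ereal a..ereal b|lebesgue. g' x)"
    using g unfolding abs_cont_with_derivative_def by blast
  ultimately show ?thesis
    by simp
qed

lemma abs_cont_with_nonpos_derivative_antimono:
  assumes g: "abs_cont_with_derivative g g'" and neg: "AE x in lebesgue. g' x \<le> 0"
    and le: "a \<le> b"
  shows "g b \<le> g a"
proof -
  have "AE x in lebesgue. 0 \<le> - (indicator (einterval (ereal a) (ereal b)) x *\<^sub>R g' x)"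
    using neg by eventually_elim (simp add: mult_nonneg_nonpos)
  then have "0 \<le> (\<integral>x. - (indicator (einterval (ereal a) (ereal b)) x *\<^sub>R g' x) \<partial>lebesgue)"
    by (rule integral_nonneg_AE)
  then have "(LINT x=ereal a..ereal b|lebesgue. g' x) \<le> 0"
    using le unfolding interval_lebesgue_integral_def set_lebesgue_integral_def by simp
  moreover have "g b = g a + (LINT x=ereal a..ereal b|lebesgue. g' x)"
    using g unfolding abs_cont_with_derivative_def by blast
  ultimately show ?thesis
    by simp
qed

lemma L_interp_uminus: "L_interp \<phi> (- a) (- v) (- w) = - L_interp \<phi> a v w"
proof -
  have "(- v - - a) / (- w - - v) = (v - a) / (w - v)"
    using minus_divide_divide[of "v - a" "w - v"] by simp
  then show ?thesis
    unfolding L_interp_def by (simp add: field_simps)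
qed

lemma interface_flux_uminus:
  "interface_flux (\<lambda>a b. - \<Phi> (- a) (- b)) \<phi> (\<lambda>l. - x l) j = - interface_flux \<Phi> \<phi> x j"
  by (simp add: interface_flux_def interface_minus_def interface_plus_def R_interp_def
      L_interp_uminus)

lemma lipschitz_on_reflected_flux:
  fixes \<Phi> :: "real \<Rightarrow> real \<Rightarrow> real"
  assumes Phi: "\<And>K. compact K \<Longrightarrow> \<exists>C. C-lipschitz_on K (\<lambda>(a, b). \<Phi> a b)"
    and K: "compact K"
  shows "\<exists>C. C-lipschitz_on K (\<lambda>(a, b). - \<Phi> (- a) (- b))"
proof -
  obtain C where C: "C-lipschitz_on (uminus ` K) (\<lambda>(a, b). \<Phi> a b)"
    using Phi[of "uminus ` K"] compact_negations[OF K] by blast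
  have "C-lipschitz_on K (\<lambda>(a, b). - \<Phi> (- a) (- b))"
  proof (rule lipschitz_onI)
    fix p q assume pq: "p \<in> K" "q \<in> K"
    show "dist (case p of (a, b) \<Rightarrow> - \<Phi> (- a) (- b)) (case q of (a, b) \<Rightarrow> - \<Phi> (- a) (- b))
        \<le> C * dist p q"
      using lipschitz_onD[OF C, of "- p" "- q"] pq
      by (simp add: split_beta dist_minus)
  qed (use C lipschitz_on_nonneg in blast)
  then show ?thesis ..
qed

lemma bounded_linear_apply_bcontfun: "bounded_linear (\<lambda>g. apply_bcontfun g x)"
  by (rule bounded_linear_intro[of _ 1]) (simp_all add: norm_bounded)

theorem theorem3p2:
  fixes h \<alpha> T :: real
    and \<phi> f :: "real \<Rightarrow> real"
    and \<Phi> \<Phi>u \<Phi>v :: "real \<Rightarrow> real \<Rightarrow> real"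
    and u0 :: "int \<Rightarrow> real"
    and u u' :: "real \<Rightarrow> (int \<Rightarrow>\<^sub>C real)"
  assumes h_pos: "h > 0"
    and limiter_le_1: "\<And>r. r \<le> 1 \<Longrightarrow> max 0 r \<le> \<phi> r \<and> \<phi> r \<le> 1"
    and limiter_ge_1: "\<And>r. r \<ge> 1 \<Longrightarrow> 1 \<le> \<phi> r \<and> \<phi> r \<le> min r 2"
    and limiter_sym: "\<And>r. r \<ge> 1 \<Longrightarrow> \<phi> r \<le> r * \<phi> (1 / r)"
    and L_lipschitz: "\<exists>C. C-lipschitz_on UNIV (\<lambda>(a, b, c). L_interp \<phi> a b c)"
    and alpha: "1 \<le> \<alpha>" "\<alpha> \<le> 2"
    and limiter_nonpos: "\<And>r. r \<le> 0 \<Longrightarrow> \<phi> r \<le> (\<alpha> - 2) * r"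
    and limiter_pos: "\<And>r. r > 0 \<Longrightarrow> \<phi> r \<le> \<alpha>"
    and f_convex: "convex_on UNIV f"
    and f_C2: "f differentiable_on UNIV" "deriv f C1_differentiable_on UNIV"
    and flux_consistent: "\<And>a. \<Phi> a a = f a"
    and flux_lipschitz: "\<And>K. compact K \<Longrightarrow> \<exists>C. C-lipschitz_on K (\<lambda>(a, b). \<Phi> a b)"
    and flux_abs_cont_u: "\<And>b. abs_cont_with_derivative (\<lambda>a. \<Phi> a b) (\<lambda>a. \<Phi>u a b)"
    and flux_abs_cont_v: "\<And>a. abs_cont_with_derivative (\<lambda>b. \<Phi> a b) (\<lambda>b. \<Phi>v a b)"
    and flux_mono_u: "\<And>b. AE a in lebesgue. \<Phi>u a b \<ge> 0"
    and flux_mono_v: "\<And>a. AE b in lebesgue. \<Phi>v a b \<le> 0"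
    and u0_bounded: "bdd_above (range (\<lambda>j. \<bar>u0 j\<bar>))"
    and u0_bv: "(\<lambda>j. \<bar>u0 (j + 1) - u0 j\<bar>) summable_on UNIV"
    and T_pos: "T > 0"
    and u_deriv: "\<And>t. t \<in> {0..T} \<Longrightarrow> (u has_vector_derivative u' t) (at t within {0..T})"
    and u'_cont: "continuous_on {0..T} u'"
    and scheme: "\<And>t j. t \<in> {0..T} \<Longrightarrow>
      apply_bcontfun (u' t) j
        + 1 / h * (interface_flux \<Phi> \<phi> (apply_bcontfun (u t)) j
                   - interface_flux \<Phi> \<phi> (apply_bcontfun (u t)) (j - 1)) = 0"
    and initial: "\<And>j. apply_bcontfun (u 0) j = u0 j"
  shows "\<forall>j. \<forall>t\<in>{0..T}. (INF l. u0 l) \<le> apply_bcontfun (u t) j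
                         \<and> apply_bcontfun (u t) j \<le> (SUP l. u0 l)"
proof -
  interpret alpha_limiter \<phi> \<alpha>
  proof
    fix r :: real
    show "0 \<le> \<phi> r"
      using limiter_le_1[of r] limiter_ge_1[of r] by linarith
    show "\<phi> r \<le> \<alpha>"
      using limiter_le_1[of r] limiter_pos[of r] alpha(1) by linarith
  qed (use alpha limiter_nonpos in auto)

  have mono: "\<Phi> a b \<le> \<Phi> a' b" if "a \<le> a'" for a a' b
    by (rule abs_cont_with_nonneg_derivative_mono[OF flux_abs_cont_u flux_mono_u that])
  have anti: "\<Phi> a b' \<le> \<Phi> a b" if "b \<le> b'" for a b b'
    by (rule abs_cont_with_nonpos_derivative_antimono[OF flux_abs_cont_v flux_mono_v that])

  have "continuous_on {0..T} u"
    using u_deriv by (rule continuous_on_vector_derivative)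
  then have "bounded (u ` {0..T})"
    by (intro compact_imp_bounded compact_continuous_image) auto
  then obtain B where B: "\<And>t. t \<in> {0..T} \<Longrightarrow> norm (u t) \<le> B"
    unfolding bounded_iff by blast
  have bound: "\<bar>u t j\<bar> \<le> B" if "t \<in> {0..T}" for t j
    using norm_bounded[of "u t" j] B[OF that] by simp
  have deriv: "((\<lambda>s. u s j) has_real_derivative u' t j) (at t within {0..T})"
    if "t \<in> {0..T}" for t j
    using bounded_linear.has_vector_derivative[OF bounded_linear_apply_bcontfun u_deriv[OF that]]
    by (simp add: has_real_derivative_iff_has_vector_derivative)

  have bdd: "bdd_above (range u0)" "bdd_below (range u0)"
    using u0_bounded unfolding bdd_above_def bdd_below_def
    by (auto simp: abs_le_iff) (metis minus_le_iff)
  show ?thesis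
  proof (intro allI ballI conjI)
    fix j t assume t: "t \<in> {0..T}"
    show "u t j \<le> (SUP l. u0 l)"
      by (rule maximum_principle[where u = "\<lambda>t. apply_bcontfun (u t)",
            OF h_pos T_pos L_lipschitz flux_lipschitz mono anti bound deriv scheme _ t])
        (simp_all add: initial cSUP_upper bdd)
    have "- u t j \<le> - (INF l. u0 l)"
    proof (rule maximum_principle[where u = "\<lambda>t l. - u t l" and u' = "\<lambda>t l. - u' t l",
          OF h_pos T_pos L_lipschitz lipschitz_on_reflected_flux[OF flux_lipschitz]])
      show "\<bar>- u t l\<bar> \<le> B" if "t \<in> {0..T}" for t l
        using bound[OF that] by simp
      show "((\<lambda>s. - u s l) has_real_derivative - u' t l) (at t within {0..T})"
        if "t \<in> {0..T}" for t l
        using deriv[OF that] by (rule DERIV_minus)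
      show "- u' t l + 1 / h *
          (interface_flux (\<lambda>a b. - \<Phi> (- a) (- b)) \<phi> (\<lambda>l. - u t l) l
            - interface_flux (\<lambda>a b. - \<Phi> (- a) (- b)) \<phi> (\<lambda>l. - u t l) (l - 1)) = 0"
        if "t \<in> {0..T}" for t l
        unfolding interface_flux_uminus using scheme[OF that, of l] by (simp add: diff_divide_distrib)
    qed (use mono anti t in \<open>simp_all add: initial cINF_lower bdd\<close>)
    then show "(INF l. u0 l) \<le> u t j"
      by simp
  qed
qed

end
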